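(* Let $d\ge1$, $n\ge1$, let $X=\{x_1,\dots,x_n\}\subset\mathbb{R}^d$ be distinct points, $m\colon\mathbb{R}^d\to\mathbb{R}$ a function, $Y=(y_1,\dots,y_n)\in\mathbb{R}^n$ and $Y_m=(y_i-m(x_i))_{i=1}^n$. Let $K(x,y)=\Phi(x-y)$, $x,y\in\mathbb{R}^d$, be a positive-definite kernel, where $\Phi\colon\mathbb{R}^d\to\mathbb{R}$ is continuous and integrable and there are constants $C_1,C_2>0$ and $\alpha>d/2$ such that $C_1(1+\|\xi\|^2)^{-\alpha}\le\widehat\Phi(\xi)\le C_2(1+\|\xi\|^2)^{-\alpha}$ for all $\xi\in\mathbb{R}^d$. For $\lambda>0$ set $K_\lambda(x,y)=\Phi((x-y)/\lambda)$ and let $$\mu_\lambda(x)=m(x)+K_\lambda(x,X)^{\mathsf T}K_\lambda(X,X)^{-1}Y_m,$$ $$P_\lambda(x,y)^2=K_\lambda(x,y)-K_\lambda(x,X)^{\mathsf T}K_\lambda(X,X)^{-1}K_\lambda(X,y).$$ If $Y_m=(c,\dots,c)$ for some $c\in\mathbb{R}$, then $$\lim_{\lambda\to\infty}\mu_\lambda(x)=m(x)+c\quad\text{and}\quad\lim_{\lambda\to\infty}|P_\lambda(x,y)|=0$$ for any $x,y\in\mathbb{R}^d$.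
   Context: A kernel is a symmetric function $K\colon\mathbb{R}^d\times\mathbb{R}^d\to\mathbb{R}$; it is (strictly) positive-definite if $\sum_{i,j}a_ia_jK(z_i,z_j)>0$ for all $N\in\mathbb{N}$, all non-zero $a\in\mathbb{R}^N$ and all distinct $z_1,\dots,z_N$. $K_\lambda(X,X)=(K_\lambda(x_i,x_j))_{i,j=1}^n$, $K_\lambda(x,X)=(K_\lambda(x,x_i))_{i=1}^n$ and $K_\lambda(X,y)=(K_\lambda(x_i,y))_{i=1}^n$ (column vectors). The Fourier transform is $\widehat f(\xi)=\int_{\mathbb{R}^d}f(x)e^{-\mathrm{i}\xi^{\mathsf T}x}\,dx$. The symbol $P_\lambda(x,y)^2$ is notation for the conditional covariance (which may be negative if $x\ne y$), and $|P_\lambda(x,y)|$ denotes the square root of the absolute value of $P_\lambda(x,y)^2$. *)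

theory Defs
  imports "HOL-Analysis.Analysis"
begin

definition positive_definite_kernel :: "('a \<Rightarrow> 'a \<Rightarrow> real) \<Rightarrow> bool" where
  "positive_definite_kernel K \<longleftrightarrow>
     (\<forall>x y. K x y = K y x) \<and>
     (\<forall>(N::nat) (a::nat \<Rightarrow> real) (z::nat \<Rightarrow> 'a).
        inj_on z {..<N} \<longrightarrow> (\<exists>i<N. a i \<noteq> 0) \<longrightarrow>
        (\<Sum>i<N. \<Sum>j<N. a i * a j * K (z i) (z j)) > 0)"

definition fourier_transform :: "('a::euclidean_space \<Rightarrow> real) \<Rightarrow> 'a \<Rightarrow> complex" where
  "fourier_transform f \<xi> =
     (LINT x|lborel. complex_of_real (f x) * exp (- (\<i> * complex_of_real (\<xi> \<bullet> x))))"

definition scaled_kernel ::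
    "('a::real_vector \<Rightarrow> real) \<Rightarrow> real \<Rightarrow> 'a \<Rightarrow> 'a \<Rightarrow> real" where
  "scaled_kernel \<Phi> l x y = \<Phi> ((x - y) /\<^sub>R l)"

definition kernel_matrix :: "('a \<Rightarrow> 'a \<Rightarrow> real) \<Rightarrow> ('n::finite \<Rightarrow> 'a) \<Rightarrow> real^'n^'n" where
  "kernel_matrix K X = (\<chi> i j. K (X i) (X j))"

definition kernel_row :: "('a \<Rightarrow> 'a \<Rightarrow> real) \<Rightarrow> 'a \<Rightarrow> ('n::finite \<Rightarrow> 'a) \<Rightarrow> real^'n" where
  "kernel_row K x X = (\<chi> i. K x (X i))"

definition kernel_col :: "('a \<Rightarrow> 'a \<Rightarrow> real) \<Rightarrow> ('n::finite \<Rightarrow> 'a) \<Rightarrow> 'a \<Rightarrow> real^'n" where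
  "kernel_col K X y = (\<chi> i. K (X i) y)"

definition residual :: "('a \<Rightarrow> real) \<Rightarrow> ('n::finite \<Rightarrow> 'a) \<Rightarrow> real^'n \<Rightarrow> real^'n" where
  "residual m X Y = (\<chi> i. Y $ i - m (X i))"

definition conditional_mean ::
    "('a \<Rightarrow> 'a \<Rightarrow> real) \<Rightarrow> ('a \<Rightarrow> real) \<Rightarrow> ('n::finite \<Rightarrow> 'a) \<Rightarrow> real^'n \<Rightarrow> 'a \<Rightarrow> real" where
  "conditional_mean K m X Y x =
     m x + kernel_row K x X \<bullet> (matrix_inv (kernel_matrix K X) *v residual m X Y)"

definition conditional_cov ::
    "('a \<Rightarrow> 'a \<Rightarrow> real) \<Rightarrow> ('n::finite \<Rightarrow> 'a) \<Rightarrow> 'a \<Rightarrow> 'a \<Rightarrow> real" where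
  "conditional_cov K X x y =
     K x y - kernel_row K x X \<bullet> (matrix_inv (kernel_matrix K X) *v kernel_col K X y)"

text \<open>The quantity written |P(x,y)|: the symbol P(x,y)^2 denotes the conditional covariance,
  which need not be nonnegative off the diagonal.\<close>

definition abs_P :: "('a \<Rightarrow> 'a \<Rightarrow> real) \<Rightarrow> ('n::finite \<Rightarrow> 'a) \<Rightarrow> 'a \<Rightarrow> 'a \<Rightarrow> real" where
  "abs_P K X x y = sqrt \<bar>conditional_cov K X x y\<bar>"

text \<open>The Fourier transform of an even real function is real, so for a symmetric kernel
  \<open>\<Phi> (x - y)\<close> an inequality on the transform of \<open>\<Phi>\<close> is the one on its real part.\<close>

lemma fourier_transform_even_real:
  fixes f :: "'a::euclidean_space \<Rightarrow> real"
  assumes even: "\<And>x. f (- x) = f x" and f: "integrable lborel f"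
  shows "Im (fourier_transform f \<xi>) = 0"
proof -
  let ?g = "\<lambda>x. complex_of_real (f x) * exp (- (\<i> * complex_of_real (\<xi> \<bullet> x)))"
  have [measurable]: "f \<in> borel_measurable borel"
    using borel_measurable_integrable[OF f] by simp
  have uminus: "distr lborel borel uminus = (lborel :: 'a measure)"
    using lborel_affine[of "-1" "0 :: 'a"] by (simp add: density_1 one_ennreal_def[symmetric])
  have "cnj (fourier_transform f \<xi>) = (LINT x|lborel. cnj (?g x))"
    unfolding fourier_transform_def by (simp only: Bochner_Integration.integral_cnj)
  also have "\<dots> = (LINT x|lborel. ?g (- x))"
    by (simp add: even exp_cnj)
  also have "\<dots> = (LINT x|distr lborel borel uminus. ?g x)"
    by (rule integral_distr[symmetric]) measurable
  also have "\<dots> = fourier_transform f \<xi>"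
    unfolding uminus fourier_transform_def ..
  finally show ?thesis
    using Reals_cnj_iff complex_is_Real_iff by blast
qed

end

theory Submission
  imports Defs "HOL-Probability.Characteristic_Functions"
begin

text \<open>
  Put \<open>K = scaled_kernel \<Phi> l\<close> and let \<open>u\<close> be the vector of prediction weights at \<open>x\<close>, that is
  the kernel matrix inverse applied to the vector of the values \<open>K (X i) x\<close>. Since the residual is
  constant, the conditional mean is \<open>m x + c * (\<Sum>i. u $ i)\<close>. So it suffices for the first limit that the weights
  sum to \<open>1\<close> in the limit. The difficulty is that for two or more data points the inverse of the kernel matrix
  blows up, because the kernel matrix tends to a matrix of rank one. Let \<open>Q\<close> be the quadratic form of \<open>K\<close> on the points \<open>x\<close> and \<open>X i\<close>. The
  conditional variance at \<open>x\<close> is the value of \<open>Q\<close> at the coefficients \<open>1\<close> and \<open>- u\<close> of the prediction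
  error (\<open>conditional_cov_quadratic\<close>). Two estimates finish the proof.

  \<^item> The variance tends to zero: it is at most the variance of the increment from \<open>X i\<close> to \<open>x\<close>,
    namely \<open>2 * \<Phi> 0 - 2 * \<Phi> ((X i - x) / l)\<close> (\<open>conditional_var_le\<close>), and \<open>\<Phi>\<close> is continuous at \<open>0\<close>.
    Covariances off the diagonal are bounded by the mean of the two variances.

  \<^item> The variance controls the weights: there is a constant \<open>B\<close>, depending on \<open>\<Phi>\<close> and the number of
    points but neither on their position nor on \<open>l\<close>, such that the square of the sum of the coefficients is at
    most \<open>B\<close> times the form (\<open>sum_squared_le_quadratic_form\<close>). Hence
    \<open>(1 - (\<Sum>i. u $ i))\<^sup>2\<close> is at most \<open>B\<close> times the variance.

  The second estimate expresses that some function which equals \<open>1\<close> on the points has a native space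
  norm bounded independently of the points. Such a function is built from Gaussians: one minus the product
  over \<open>j\<close> of \<open>1 - exp (- (norm (w - z j))\<^sup>2)\<close>. It is a signed sum of multiples of translated Gaussians,
  which belong to the native space of \<open>\<Phi>\<close> with bounded norm, since the transform of \<open>\<Phi>\<close> decays at most
  algebraically (\<open>gaussian_form_dominated\<close>).

  The comparison of \<open>\<Phi>\<close> with Gaussians rests on the fact that a bounded continuous integrable function
  whose Fourier transform is nonnegative has nonnegative quadratic forms
  (\<open>quadratic_form_nonneg_of_fourier\<close>). It is proved by Gaussian smoothing.
\<close>

section \<open>Fourier transform of Gaussians\<close>

text \<open>The characteristic function of the standard normal distribution, after the substitution
  \<open>x = v / sqrt (2 * s)\<close>.\<close>
lemma gaussian_fourier_real:
  fixes s t :: real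
  assumes s: "s > 0"
  shows "has_bochner_integral lborel (\<lambda>x. complex_of_real (exp (- (s * x\<^sup>2))) * iexp (t * x))
           (complex_of_real (sqrt (pi / s) * exp (- t\<^sup>2 / (4 * s))))"
proof -
  let ?r = "1 / sqrt (2 * s)"
  let ?h = "\<lambda>x. complex_of_real (exp (- (s * x\<^sup>2))) * iexp (t * x)"
  let ?f = "\<lambda>v. std_normal_density v *\<^sub>R iexp ((t * ?r) * v)"
  have r: "?r \<noteq> 0" using s by simp
  have r2: "?r\<^sup>2 = 1 / (2 * s)" using s by (simp add: power_divide)
  have int: "integrable lborel ?f"
  proof (rule Bochner_Integration.integrable_bound)
    show "integrable lborel std_normal_density" by simp
    show "AE v in lborel. norm (?f v) \<le> norm (std_normal_density v)" by simp
  qed measurable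
  have "(LINT v|lborel. ?f v) = char std_normal_distribution (t * ?r)"
    unfolding char_def by (subst integral_density) auto
  also have "\<dots> = complex_of_real (exp (- t\<^sup>2 / (4 * s)))"
    unfolding char_std_normal_distribution using r2 by (simp add: power_mult_distrib power_divide)
  finally have f: "has_bochner_integral lborel ?f (complex_of_real (exp (- t\<^sup>2 / (4 * s))))"
    using int by (simp add: has_bochner_integral_iff)
  have pt: "?h (0 + ?r * v) = complex_of_real (sqrt (2 * pi)) * ?f v" for v
  proof -
    have "s * (0 + ?r * v)\<^sup>2 = v\<^sup>2 / 2"
      using s r2 by (simp add: power_mult_distrib power_divide)
    then show ?thesis by (simp add: std_normal_density_def scaleR_conv_of_real mult.assoc)
  qed
  have "has_bochner_integral lborel (\<lambda>v. ?h (0 + ?r * v))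
      (complex_of_real (sqrt (2 * pi)) * complex_of_real (exp (- t\<^sup>2 / (4 * s))))"
    unfolding pt using f by (rule has_bochner_integral_mult_right)
  moreover have "complex_of_real (sqrt (2 * pi)) * complex_of_real (exp (- t\<^sup>2 / (4 * s)))
      = complex_of_real (sqrt (pi / s) * exp (- t\<^sup>2 / (4 * s))) /\<^sub>R \<bar>?r\<bar>"
  proof -
    have "sqrt (2 * pi) = sqrt (2 * s) * sqrt (pi / s)"
      using s by (simp flip: real_sqrt_mult)
    then show ?thesis using s by (simp add: scaleR_conv_of_real)
  qed
  ultimately show ?thesis
    by (intro iffD2[OF lborel_has_bochner_integral_real_affine_iff[OF r, of ?h _ 0]]) (simp only:)
qed

text \<open>Both the Gaussian and the character factor over the coordinates, so this is a product of
  one-dimensional integrals.\<close>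
lemma gaussian_fourier:
  fixes \<xi> :: "'a::euclidean_space"
  assumes s: "s > 0"
  shows "has_bochner_integral lborel
           (\<lambda>x. complex_of_real (exp (- (s * (norm x)\<^sup>2))) * exp (\<i> * complex_of_real (\<xi> \<bullet> x)))
           (complex_of_real (sqrt (pi / s) ^ DIM('a) * exp (- (norm \<xi>)\<^sup>2 / (4 * s))))"
proof -
  interpret product_sigma_finite "\<lambda>b::'a. lborel :: real measure" ..
  let ?g = "\<lambda>b x. complex_of_real (exp (- (s * x\<^sup>2))) * iexp ((\<xi> \<bullet> b) * x)"
  let ?v = "\<lambda>f. \<Sum>b\<in>Basis. f b *\<^sub>R b :: 'a"
  let ?h = "\<lambda>x. complex_of_real (exp (- (s * (norm x)\<^sup>2))) * exp (\<i> * complex_of_real (\<xi> \<bullet> x))"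
  have nrm: "(norm x)\<^sup>2 = (\<Sum>b\<in>Basis. (x \<bullet> b)\<^sup>2)" for x :: 'a
    using euclidean_inner[of x x] by (simp add: dot_square_norm power2_eq_square)
  have g: "integrable lborel (?g b)"
    "(LINT x|lborel. ?g b x) = complex_of_real (sqrt (pi / s) * exp (- (\<xi> \<bullet> b)\<^sup>2 / (4 * s)))" for b
    using gaussian_fourier_real[OF s, of "\<xi> \<bullet> b"] by (simp_all only: has_bochner_integral_iff)
  have eq: "?h (?v f) = (\<Prod>b\<in>Basis. ?g b (f b))" for f
  proof -
    have "exp (- (s * (norm (?v f))\<^sup>2)) = (\<Prod>b\<in>Basis. exp (- (s * (f b)\<^sup>2)))"
      unfolding nrm by (simp add: exp_sum[symmetric] sum_negf sum_distrib_left)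
    moreover have "exp (\<i> * complex_of_real (\<xi> \<bullet> ?v f)) = (\<Prod>b\<in>Basis. iexp ((\<xi> \<bullet> b) * f b))"
      by (simp add: inner_sum_right exp_sum[symmetric] sum_distrib_left mult.commute)
    ultimately show ?thesis by (simp only: prod.distrib of_real_prod)
  qed
  have "(\<Prod>b\<in>Basis. complex_of_real (sqrt (pi / s) * exp (- (\<xi> \<bullet> b)\<^sup>2 / (4 * s))))
      = complex_of_real (sqrt (pi / s) ^ DIM('a) * exp (- (norm \<xi>)\<^sup>2 / (4 * s)))"
    unfolding nrm
    by (simp add: prod.distrib exp_sum[symmetric] sum_negf sum_divide_distrib flip: of_real_prod)
  then have "has_bochner_integral (\<Pi>\<^sub>M b\<in>Basis. lborel) (\<lambda>f. ?h (?v f))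
      (complex_of_real (sqrt (pi / s) ^ DIM('a) * exp (- (norm \<xi>)\<^sup>2 / (4 * s))))"
    unfolding eq has_bochner_integral_iff
    using product_integrable_prod[of Basis ?g] product_integral_prod[of Basis ?g] g by simp
  then have "has_bochner_integral (distr (\<Pi>\<^sub>M b\<in>Basis. lborel) borel ?v) ?h
      (complex_of_real (sqrt (pi / s) ^ DIM('a) * exp (- (norm \<xi>)\<^sup>2 / (4 * s))))"
    by (subst has_bochner_integral_distr) measurable
  then show ?thesis
    by (simp only: lborel_eq[symmetric])
qed

section \<open>Nonnegative Fourier transforms and nonnegative quadratic forms\<close>

text \<open>The points \<open>z i\<close> are allowed to coincide. This is what makes it possible to treat an evaluation
  point that is one of the data points like any other.\<close>
definition quadratic_form :: "('a::ab_group_add \<Rightarrow> real) \<Rightarrow> 'i set \<Rightarrow> ('i \<Rightarrow> 'a) \<Rightarrow> ('i \<Rightarrow> real) \<Rightarrow> real" where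
  "quadratic_form F I z a = (\<Sum>i\<in>I. \<Sum>j\<in>I. a i * a j * F (z i - z j))"

lemma quadratic_form_cmult: "quadratic_form (\<lambda>w. c * F w) I z a = c * quadratic_form F I z a"
  by (simp add: quadratic_form_def sum_distrib_left mult_ac)

lemma quadratic_form_diff:
  "quadratic_form (\<lambda>w. F w - G w) I z a = quadratic_form F I z a - quadratic_form G I z a"
  by (simp add: quadratic_form_def sum_subtractf right_diff_distrib)

lemma gaussian_integrable:
  assumes "s > 0"
  shows "integrable lborel (\<lambda>x::'a::euclidean_space. exp (- (s * (norm x)\<^sup>2)))"
  using gaussian_fourier[OF assms, of "0::'a"] by (simp add: has_bochner_integral_iff complex_of_real_integrable_eq)

lemma gaussian_integral:
  assumes "s > 0"
  shows "(LINT x|lborel. exp (- (s * (norm (x::'a::euclidean_space))\<^sup>2))) = sqrt (pi / s) ^ DIM('a)"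
  using gaussian_fourier[OF assms, of "0::'a"]
  by (simp add: has_bochner_integral_iff flip: of_real_power of_real_mult)

text \<open>Fourier inversion for the convolution of \<open>\<Psi>\<close> with a Gaussian: write the Gaussian kernel itself
  as a Fourier integral and exchange the order of integration. The factor
  \<open>exp (- (s * (norm \<xi>)\<^sup>2))\<close> makes the double integral converge absolutely.\<close>
lemma gaussian_smoothing_fourier:
  fixes \<Psi> :: "'a::euclidean_space \<Rightarrow> real"
  assumes \<Psi>: "integrable lborel \<Psi>" and s: "s > 0"
  defines "g \<equiv> \<lambda>w \<xi>. complex_of_real (exp (- (s * (norm \<xi>)\<^sup>2))) * exp (\<i> * complex_of_real (w \<bullet> \<xi>))
                   * fourier_transform \<Psi> \<xi>"
  shows "integrable lborel (g w)"
    and "complex_of_real (sqrt (pi / s) ^ DIM('a) *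
            (LINT y|lborel. \<Psi> y * exp (- (norm (w - y))\<^sup>2 / (4 * s)))) = (LINT \<xi>|lborel. g w \<xi>)"
proof -
  let ?e = "\<lambda>\<xi>::'a. complex_of_real (exp (- (s * (norm \<xi>)\<^sup>2)))"
  let ?F = "\<lambda>y \<xi>. complex_of_real (\<Psi> y) * (?e \<xi> * exp (\<i> * complex_of_real ((w - y) \<bullet> \<xi>)))"
  have [measurable]: "\<Psi> \<in> borel_measurable borel"
    using borel_measurable_integrable[OF \<Psi>] by simp
  have inner: "has_bochner_integral lborel (?F y)
      (complex_of_real (\<Psi> y) * complex_of_real (sqrt (pi / s) ^ DIM('a) * exp (- (norm (w - y))\<^sup>2 / (4 * s))))" for y
    by (rule has_bochner_integral_mult_right[OF gaussian_fourier[OF s]])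
  have F: "integrable (lborel \<Otimes>\<^sub>M lborel) (case_prod ?F)"
  proof (rule lborel_pair.Fubini_integrable)
    have "(LINT \<xi>|lborel. cmod (?F y \<xi>)) = sqrt (pi / s) ^ DIM('a) * \<bar>\<Psi> y\<bar>" for y
      by (simp add: norm_mult gaussian_integral[OF s])
    then show "integrable lborel (\<lambda>y. LINT \<xi>|lborel. cmod (case_prod ?F (y, \<xi>)))"
      using \<Psi> by simp
    show "AE y in lborel. integrable lborel (\<lambda>\<xi>. case_prod ?F (y, \<xi>))"
      using inner by (simp add: has_bochner_integral_iff)
  qed measurable
  have snd: "(LINT y|lborel. ?F y \<xi>) = g w \<xi>" for \<xi>
  proof -
    have "?F y \<xi> = (?e \<xi> * exp (\<i> * complex_of_real (w \<bullet> \<xi>))) *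
        (complex_of_real (\<Psi> y) * exp (- (\<i> * complex_of_real (\<xi> \<bullet> y))))" for y
      by (simp add: inner_diff_left inner_commute[of y] right_diff_distrib exp_diff exp_minus divide_inverse)
    then show ?thesis
      by (simp only: integral_mult_right_zero g_def fourier_transform_def)
  qed
  show "integrable lborel (g w)"
    using lborel_pair.integrable_snd[OF F] by (simp only: snd)
  have "complex_of_real (sqrt (pi / s) ^ DIM('a) *
            (LINT y|lborel. \<Psi> y * exp (- (norm (w - y))\<^sup>2 / (4 * s))))
      = (LINT y|lborel. complex_of_real (\<Psi> y * (sqrt (pi / s) ^ DIM('a) * exp (- (norm (w - y))\<^sup>2 / (4 * s)))))"
    by (simp only: integral_complex_of_real flip: integral_mult_right_zero)
      (simp add: mult_ac)
  also have "\<dots> = (LINT y|lborel. (LINT \<xi>|lborel. ?F y \<xi>))"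
    using inner by (simp only: has_bochner_integral_iff of_real_mult)
  also have "\<dots> = (LINT \<xi>|lborel. (LINT y|lborel. ?F y \<xi>))"
    by (rule lborel_pair.Fubini_integral[OF F, symmetric])
  finally show "complex_of_real (sqrt (pi / s) ^ DIM('a) *
            (LINT y|lborel. \<Psi> y * exp (- (norm (w - y))\<^sup>2 / (4 * s)))) = (LINT \<xi>|lborel. g w \<xi>)"
    by (simp only: snd)
qed

text \<open>The easy half of Bochner's theorem: by the previous lemma the form is the integral of the
  transform of \<open>\<Psi>\<close> against a Gaussian weight times
  \<open>\<bar>\<Sum>i. a i * exp (\<i> * (z i \<bullet> \<xi>))\<bar>\<^sup>2\<close>. Only the real part of the transform matters, because the form is
  a real number.\<close>
lemma smoothed_quadratic_form_nonneg:
  fixes \<Psi> :: "'a::euclidean_space \<Rightarrow> real"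
  assumes \<Psi>: "integrable lborel \<Psi>" and nonneg: "\<And>\<xi>. Re (fourier_transform \<Psi> \<xi>) \<ge> 0" and s: "s > 0"
  shows "quadratic_form (\<lambda>w. LINT y|lborel. \<Psi> y * exp (- (norm (w - y))\<^sup>2 / (4 * s))) I z a \<ge> 0"
proof -
  let ?D = "sqrt (pi / s) ^ DIM('a)"
  let ?S = "\<lambda>w. LINT y|lborel. \<Psi> y * exp (- (norm (w - y))\<^sup>2 / (4 * s))"
  let ?g = "\<lambda>w \<xi>. complex_of_real (exp (- (s * (norm \<xi>)\<^sup>2))) * exp (\<i> * complex_of_real (w \<bullet> \<xi>))
                   * fourier_transform \<Psi> \<xi>"
  let ?T = "\<lambda>\<xi>. \<Sum>i\<in>I. complex_of_real (a i) * exp (\<i> * complex_of_real (z i \<bullet> \<xi>))"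
  let ?G = "\<lambda>\<xi>. \<Sum>i\<in>I. \<Sum>j\<in>I. complex_of_real (a i * a j) * ?g (z i - z j) \<xi>"
  have T: "?G \<xi> = complex_of_real (exp (- (s * (norm \<xi>)\<^sup>2)) * (cmod (?T \<xi>))\<^sup>2) * fourier_transform \<Psi> \<xi>" for \<xi>
  proof -
    have "complex_of_real ((cmod (?T \<xi>))\<^sup>2) = ?T \<xi> * cnj (?T \<xi>)"
      by (rule complex_norm_square)
    also have "\<dots> = (\<Sum>i\<in>I. \<Sum>j\<in>I. complex_of_real (a i * a j) * exp (\<i> * complex_of_real ((z i - z j) \<bullet> \<xi>)))"
      by (simp add: sum_product exp_cnj inner_diff_left right_diff_distrib exp_diff exp_minus divide_inverse mult_ac)
    finally show ?thesis
      by (simp add: sum_distrib_left sum_distrib_right mult_ac)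
  qed
  have int: "integrable lborel ?G"
    by (intro Bochner_Integration.integrable_sum integrable_mult_right gaussian_smoothing_fourier(1)[OF \<Psi> s])
  have "complex_of_real (?D * quadratic_form ?S I z a)
      = (\<Sum>i\<in>I. \<Sum>j\<in>I. complex_of_real (a i * a j) * complex_of_real (?D * ?S (z i - z j)))"
    by (simp add: quadratic_form_def sum_distrib_left mult_ac)
  also have "\<dots> = (\<Sum>i\<in>I. \<Sum>j\<in>I. LINT \<xi>|lborel. complex_of_real (a i * a j) * ?g (z i - z j) \<xi>)"
    by (simp only: gaussian_smoothing_fourier(2)[OF \<Psi> s] integral_mult_right_zero)
  also have "\<dots> = (LINT \<xi>|lborel. ?G \<xi>)"
    by (subst Bochner_Integration.integral_sum,
        intro Bochner_Integration.integrable_sum integrable_mult_right gaussian_smoothing_fourier(1)[OF \<Psi> s],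
        subst Bochner_Integration.integral_sum,
        intro integrable_mult_right gaussian_smoothing_fourier(1)[OF \<Psi> s], rule refl)
  finally have "?D * quadratic_form ?S I z a = Re (LINT \<xi>|lborel. ?G \<xi>)"
    by (metis Re_complex_of_real)
  also have "\<dots> = (LINT \<xi>|lborel. Re (?G \<xi>))"
    by (rule integral_Re[OF int, symmetric])
  also have "\<dots> \<ge> 0"
    unfolding T by (intro integral_nonneg_AE) (simp add: nonneg)
  finally have "?D * 0 \<le> ?D * quadratic_form ?S I z a" by simp
  then show ?thesis
    by (rule mult_left_le_imp_le) (use s in simp)
qed

lemma lborel_integral_affine:
  fixes f :: "'a::euclidean_space \<Rightarrow> real"
  assumes [measurable]: "f \<in> borel_measurable borel" and c: "c > 0"
  shows "(LINT y|lborel. f y) = c ^ DIM('a) * (LINT u|lborel. f (w + c *\<^sub>R u))"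
proof -
  have "(LINT y|lborel. f y) = (LINT y|density (distr lborel borel (\<lambda>u. w + c *\<^sub>R u)) (\<lambda>_. \<bar>c\<bar>^DIM('a)). f y)"
    using c lborel_affine[of c w] by simp
  also have "\<dots> = c ^ DIM('a) * (LINT u|lborel. f (w + c *\<^sub>R u))"
    using c by (subst integral_density) (auto simp: integral_distr)
  finally show ?thesis .
qed

text \<open>Rescaled Gaussians are an approximate identity. The parameter is
  \<open>s = 1 / (4 * (n + 1)\<^sup>2)\<close>, so that the kernel is \<open>exp (- (n + 1)\<^sup>2 * (norm (w - y))\<^sup>2)\<close> and the
  substitution \<open>y = w + u / (n + 1)\<close> turns it into a fixed Gaussian in \<open>u\<close>.\<close>
lemma gaussian_smoothing_tendsto:
  fixes \<Psi> :: "'a::euclidean_space \<Rightarrow> real"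
  assumes cont: "continuous_on UNIV \<Psi>" and bdd: "\<And>x. \<bar>\<Psi> x\<bar> \<le> B"
  shows "(\<lambda>n. real (Suc n) ^ DIM('a) *
            (LINT y|lborel. \<Psi> y * exp (- (norm (w - y))\<^sup>2 / (4 * (1 / (4 * (real (Suc n))\<^sup>2))))))
         \<longlonglongrightarrow> \<Psi> w * sqrt pi ^ DIM('a)"
proof -
  have [measurable]: "\<Psi> \<in> borel_measurable borel"
    using cont by (rule borel_measurable_continuous_onI)
  let ?e = "\<lambda>u::'a. exp (- (1 * (norm u)\<^sup>2))"
  have e: "integrable lborel ?e" "(LINT u|lborel. ?e u) = sqrt pi ^ DIM('a)"
    using gaussian_integrable[of 1, where 'a='a] gaussian_integral[of 1, where 'a='a] by simp_all
  have eq: "real (Suc n) ^ DIM('a) *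
            (LINT y|lborel. \<Psi> y * exp (- (norm (w - y))\<^sup>2 / (4 * (1 / (4 * (real (Suc n))\<^sup>2)))))
      = (LINT u|lborel. \<Psi> (w + (1 / real (Suc n)) *\<^sub>R u) * ?e u)" for n
    by (subst lborel_integral_affine[of _ "1 / real (Suc n)" w])
      (simp_all add: power_divide field_simps power_mult_distrib del: of_nat_Suc)
  have "(\<lambda>n. LINT u|lborel. \<Psi> (w + (1 / real (Suc n)) *\<^sub>R u) * ?e u) \<longlonglongrightarrow> (LINT u|lborel. \<Psi> w * ?e u)"
  proof (rule integral_dominated_convergence)
    show "integrable lborel (\<lambda>u. B * ?e u)" using e by simp
    show "AE u in lborel. (\<lambda>n. \<Psi> (w + (1 / real (Suc n)) *\<^sub>R u) * ?e u) \<longlonglongrightarrow> \<Psi> w * ?e u"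
    proof (intro AE_I2 tendsto_mult tendsto_const)
      fix u :: 'a
      have "(\<lambda>n. w + (1 / real (Suc n)) *\<^sub>R u) \<longlonglongrightarrow> w + 0 *\<^sub>R u"
        using lim_inverse_n' LIMSEQ_Suc by (intro tendsto_intros) blast
      then show "(\<lambda>n. \<Psi> (w + (1 / real (Suc n)) *\<^sub>R u)) \<longlonglongrightarrow> \<Psi> w"
        using cont by (auto intro: continuous_on_tendsto_compose)
    qed
    show "AE u in lborel. norm (\<Psi> (w + (1 / real (Suc n)) *\<^sub>R u) * ?e u) \<le> B * ?e u" for n
      using bdd by (simp add: abs_mult)
  qed measurable
  then show ?thesis unfolding eq using e by simp
qed

text \<open>Smoothing replaces Fourier inversion: the forms of the smoothed functions are nonnegative, and
  after rescaling they converge to the form of \<open>\<Psi>\<close> times the total mass of a Gaussian.\<close>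
lemma quadratic_form_nonneg_of_fourier:
  fixes \<Psi> :: "'a::euclidean_space \<Rightarrow> real"
  assumes \<Psi>: "integrable lborel \<Psi>" and cont: "continuous_on UNIV \<Psi>" and bdd: "\<And>x. \<bar>\<Psi> x\<bar> \<le> B"
    and nonneg: "\<And>\<xi>. Re (fourier_transform \<Psi> \<xi>) \<ge> 0"
  shows "quadratic_form \<Psi> I z a \<ge> 0"
proof -
  let ?S = "\<lambda>n w. LINT y|lborel. \<Psi> y * exp (- (norm (w - y))\<^sup>2 / (4 * (1 / (4 * (real (Suc n))\<^sup>2))))"
  let ?N = "\<lambda>n. real (Suc n) ^ DIM('a)"
  have "(\<lambda>n. quadratic_form (\<lambda>w. ?N n * ?S n w) I z a) \<longlonglongrightarrow> quadratic_form (\<lambda>w. \<Psi> w * sqrt pi ^ DIM('a)) I z a"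
    unfolding quadratic_form_def
    by (intro tendsto_sum tendsto_mult_left gaussian_smoothing_tendsto[OF cont bdd])
  moreover have "quadratic_form (\<lambda>w. ?N n * ?S n w) I z a = ?N n * quadratic_form (?S n) I z a" for n
    by (rule quadratic_form_cmult)
  moreover have "quadratic_form (?S n) I z a \<ge> 0" for n
    by (rule smoothed_quadratic_form_nonneg[OF \<Psi> nonneg]) simp
  ultimately have "quadratic_form (\<lambda>w. \<Psi> w * sqrt pi ^ DIM('a)) I z a \<ge> 0"
    by (intro LIMSEQ_le_const) auto
  then have "sqrt pi ^ DIM('a) * 0 \<le> sqrt pi ^ DIM('a) * quadratic_form \<Psi> I z a"
    by (simp only: mult.commute[of "\<Psi> _"] quadratic_form_cmult mult_zero_right)
  then show ?thesis
    by (rule mult_left_le_imp_le) simp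
qed

section \<open>Comparison with Gaussian kernels\<close>

lemma fourier_transform_gaussian:
  fixes \<xi> :: "'a::euclidean_space"
  assumes "s > 0"
  shows "fourier_transform (\<lambda>x. exp (- (s * (norm x)\<^sup>2))) \<xi>
     = complex_of_real (sqrt (pi / s) ^ DIM('a) * exp (- (norm \<xi>)\<^sup>2 / (4 * s)))"
  using gaussian_fourier[OF assms, of "- \<xi>"]
  by (simp add: fourier_transform_def has_bochner_integral_iff)

lemma fourier_transform_integrable:
  assumes "integrable lborel f"
  shows "integrable lborel (\<lambda>x. complex_of_real (f x) * exp (- (\<i> * complex_of_real (\<xi> \<bullet> x))))"
proof (rule Bochner_Integration.integrable_bound[OF assms])
  have [measurable]: "f \<in> borel_measurable borel"
    using borel_measurable_integrable[OF assms] by simp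
  show "(\<lambda>x. complex_of_real (f x) * exp (- (\<i> * complex_of_real (\<xi> \<bullet> x)))) \<in> borel_measurable lborel"
    by measurable
qed (simp add: norm_mult)

lemma fourier_transform_diff_cmult:
  assumes "integrable lborel f" "integrable lborel g"
  shows "fourier_transform (\<lambda>x. f x - c * g x) \<xi> = fourier_transform f \<xi> - complex_of_real c * fourier_transform g \<xi>"
proof -
  have "fourier_transform (\<lambda>x. f x - c * g x) \<xi> =
    (LINT x|lborel. complex_of_real (f x) * exp (- (\<i> * complex_of_real (\<xi> \<bullet> x)))
       - complex_of_real c * (complex_of_real (g x) * exp (- (\<i> * complex_of_real (\<xi> \<bullet> x)))))"
    unfolding fourier_transform_def by (simp add: left_diff_distrib mult.assoc)
  also have "\<dots> = fourier_transform f \<xi> - complex_of_real c * fourier_transform g \<xi>"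
    unfolding fourier_transform_def
    by (subst Bochner_Integration.integral_diff) (simp_all add: fourier_transform_integrable assms)
  finally show ?thesis .
qed

lemma quadratic_form_gaussian_nonneg:
  fixes z :: "'i \<Rightarrow> 'a::euclidean_space"
  assumes "s > 0"
  shows "quadratic_form (\<lambda>x. exp (- (s * (norm x)\<^sup>2))) I z a \<ge> 0"
proof (rule quadratic_form_nonneg_of_fourier[OF gaussian_integrable[OF assms]])
  show "continuous_on UNIV (\<lambda>x::'a. exp (- (s * (norm x)\<^sup>2)))"
    by (intro continuous_intros)
  show "\<bar>exp (- (s * (norm x)\<^sup>2))\<bar> \<le> 1" for x :: 'a
    using assms by simp
qed (use assms in \<open>simp add: fourier_transform_gaussian\<close>)

text \<open>A translate of the Gaussian has norm one in the native space of the Gaussian kernel. In terms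
  of forms: add the point \<open>p\<close> with coefficient \<open>- b\<close>, where \<open>b\<close> is the sum on the left;
  the enlarged form is nonnegative and equals the right-hand side minus \<open>b\<^sup>2\<close>.\<close>
lemma gaussian_sum_squared_le:
  fixes z :: "'i \<Rightarrow> 'a::euclidean_space"
  assumes s: "s > 0" and I: "finite I"
  shows "(\<Sum>i\<in>I. a i * exp (- (s * (norm (z i - p))\<^sup>2)))\<^sup>2 \<le> quadratic_form (\<lambda>x. exp (- (s * (norm x)\<^sup>2))) I z a"
proof -
  let ?b = "\<Sum>i\<in>I. a i * exp (- (s * (norm (z i - p))\<^sup>2))"
  let ?I = "insert None (Some ` I)"
  have sum: "(\<Sum>i\<in>?I. f i) = f None + (\<Sum>i\<in>I. f (Some i))" for f :: "'i option \<Rightarrow> real"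
    using I by (simp add: sum.reindex)
  have "0 \<le> quadratic_form (\<lambda>x. exp (- (s * (norm x)\<^sup>2))) ?I (case_option p z) (case_option (- ?b) a)"
    by (rule quadratic_form_gaussian_nonneg[OF s])
  also have "\<dots> = quadratic_form (\<lambda>x. exp (- (s * (norm x)\<^sup>2))) I z a - ?b\<^sup>2"
    unfolding quadratic_form_def sum option.case
    by (simp add: sum.distrib norm_minus_commute[of p] sum_distrib_left sum_distrib_right
        sum_negf sum_subtractf power2_eq_square mult_ac)
  finally show ?thesis by simp
qed

text \<open>The bound \<open>ln u \<le> u - 1\<close> at \<open>u = (1 + r) * (t / \<alpha>)\<close>, the point where it is sharp being the
  one that minimises \<open>(1 + r) * t - \<alpha> * ln (1 + r)\<close>.\<close>
lemma exp_le_Bessel_weight: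
  fixes \<alpha> t :: real
  assumes "\<alpha> > 0" "t > 0" "r \<ge> 0"
  shows "exp (- (r * t)) \<le> exp (t - \<alpha> - \<alpha> * ln (t / \<alpha>)) * (1 + r) powr (- \<alpha>)"
proof -
  have "ln ((1 + r) * (t / \<alpha>)) \<le> (1 + r) * (t / \<alpha>) - 1"
    using assms by (intro ln_le_minus_one) simp
  then have "\<alpha> * (ln (1 + r) + ln (t / \<alpha>)) \<le> \<alpha> * ((1 + r) * (t / \<alpha>) - 1)"
    using assms by (intro mult_left_mono) (auto simp only: ln_mult less_imp_le split: if_splits)
  also have "\<dots> = (1 + r) * t - \<alpha>"
    using assms by (simp add: field_simps)
  finally have "- (r * t) \<le> (t - \<alpha> - \<alpha> * ln (t / \<alpha>)) - \<alpha> * ln (1 + r)"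
    by (simp add: algebra_simps)
  then show ?thesis
    using assms by (simp add: powr_def flip: exp_add)
qed

text \<open>The transform of a Gaussian decays faster than any power, so a small multiple of it lies below
  the algebraic lower bound on the transform of \<open>\<Phi>\<close>. The difference of the two functions then has a
  nonnegative transform, hence a nonnegative form. In other words, the native space of the Gaussian
  embeds continuously in that of \<open>\<Phi>\<close>.\<close>
lemma gaussian_form_dominated:
  fixes \<Phi> :: "'a::euclidean_space \<Rightarrow> real"
  assumes int: "integrable lborel \<Phi>" and cont: "continuous_on UNIV \<Phi>" and bdd: "\<And>x. \<bar>\<Phi> x\<bar> \<le> B"
    and "C > 0" "\<alpha> > 0"
    and lower: "\<And>\<xi>. C * (1 + (norm \<xi>)\<^sup>2) powr (- \<alpha>) \<le> Re (fourier_transform \<Phi> \<xi>)"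
    and s: "s > 0"
  shows "\<exists>M>0. \<forall>(I::'i set) z a. quadratic_form (\<lambda>x. exp (- (s * (norm x)\<^sup>2))) I z a \<le> M * quadratic_form \<Phi> I z a"
proof -
  let ?G = "\<lambda>x::'a. exp (- (s * (norm x)\<^sup>2))"
  let ?t = "1 / (4 * s)"
  define E where "E = exp (?t - \<alpha> - \<alpha> * ln (?t / \<alpha>))"
  define c where "c = C / (E * sqrt (pi / s) ^ DIM('a))"
  have c: "c > 0" "c * sqrt (pi / s) ^ DIM('a) = C / E" "E > 0"
    using assms by (simp_all add: c_def E_def)
  have "quadratic_form (\<lambda>x. \<Phi> x - c * ?G x) I z a \<ge> 0" for I :: "'i set" and z a
  proof (rule quadratic_form_nonneg_of_fourier)
    show "integrable lborel (\<lambda>x. \<Phi> x - c * ?G x)"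
      using int gaussian_integrable[OF s, where 'a='a] by simp
    show "continuous_on UNIV (\<lambda>x. \<Phi> x - c * ?G x)"
      using cont by (intro continuous_intros)
    show "\<bar>\<Phi> x - c * ?G x\<bar> \<le> B + c" for x
    proof -
      have "c * ?G x \<le> c * 1" using c s by (intro mult_left_mono) simp_all
      moreover have "0 \<le> c * ?G x" using c by simp
      ultimately show ?thesis using bdd[of x] by linarith
    qed
    show "Re (fourier_transform (\<lambda>x. \<Phi> x - c * ?G x) \<xi>) \<ge> 0" for \<xi>
    proof -
      have "c * (sqrt (pi / s) ^ DIM('a) * exp (- (norm \<xi>)\<^sup>2 / (4 * s))) = C / E * exp (- ((norm \<xi>)\<^sup>2 * ?t))"
        using c(2) by (simp flip: mult.assoc)
      also have "\<dots> \<le> C / E * (E * (1 + (norm \<xi>)\<^sup>2) powr (- \<alpha>))"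
        unfolding E_def using assms by (intro mult_left_mono exp_le_Bessel_weight) auto
      also have "\<dots> \<le> Re (fourier_transform \<Phi> \<xi>)"
        using lower[of \<xi>] c by simp
      finally show ?thesis
        unfolding fourier_transform_diff_cmult[OF int gaussian_integrable[OF s]] fourier_transform_gaussian[OF s]
        by simp
    qed
  qed
  then have "quadratic_form ?G I z a \<le> 1 / c * quadratic_form \<Phi> I z a" for I :: "'i set" and z a
    using c(1) by (simp add: quadratic_form_diff quadratic_form_cmult field_simps)
  then show ?thesis using c(1) by (intro exI[of _ "1 / c"]) simp
qed

section \<open>Lower bound by the sum of the coefficients\<close>

text \<open>The parallel axis theorem: the sum of the squared distances from \<open>w\<close> to the points is
  \<open>card S\<close> times the squared distance from \<open>w\<close> to their mean \<open>p\<close>, plus a constant.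
  The factor \<open>C\<close> is the value of the product at \<open>w = p\<close>, hence at most \<open>1\<close>.\<close>
lemma gaussian_product:
  fixes z :: "'i \<Rightarrow> 'a::euclidean_space"
  assumes S: "finite S" "S \<noteq> {}"
  obtains p C where "0 \<le> C" "C \<le> 1"
    "\<And>w. (\<Prod>j\<in>S. exp (- (norm (w - z j))\<^sup>2)) = C * exp (- (real (card S) * (norm (w - p))\<^sup>2))"
proof
  let ?p = "(\<Sum>j\<in>S. z j) /\<^sub>R real (card S)"
  let ?C = "\<Prod>j\<in>S. exp (- (norm (?p - z j))\<^sup>2)"
  show "0 \<le> ?C" by (intro prod_nonneg) simp
  show "?C \<le> 1" by (intro prod_le_1) simp
  fix w
  have mean: "(\<Sum>j\<in>S. ?p - z j) = 0"
    using S by (simp add: sum_subtractf sum_constant_scaleR del: sum_constant)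
  have "(norm (w - z j))\<^sup>2 = (norm (w - ?p))\<^sup>2 + (norm (?p - z j))\<^sup>2 + 2 * ((w - ?p) \<bullet> (?p - z j))" for j
    using dot_norm[of "w - ?p" "?p - z j"] by simp
  then have "(\<Sum>j\<in>S. (norm (w - z j))\<^sup>2)
      = real (card S) * (norm (w - ?p))\<^sup>2 + (\<Sum>j\<in>S. (norm (?p - z j))\<^sup>2) + 2 * ((w - ?p) \<bullet> (\<Sum>j\<in>S. ?p - z j))"
    by (simp add: sum.distrib sum_distrib_left inner_sum_right del: sum_subtractf)
  then show "(\<Prod>j\<in>S. exp (- (norm (w - z j))\<^sup>2)) = ?C * exp (- (real (card S) * (norm (w - ?p))\<^sup>2))"
    unfolding mean by (simp add: S sum_negf flip: exp_sum exp_add)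
qed

text \<open>The decisive estimate; the constant is independent of the position of the points, so it survives
  when they collapse to a single one.

  The function \<open>1 - (\<Prod>j\<in>I. 1 - exp (- (norm (w - z j))\<^sup>2))\<close> has the value \<open>1\<close> at every point
  \<open>z i\<close>. Expanding the product over subsets \<open>S\<close> of \<open>I\<close> presents it as a signed sum of products of
  translated Gaussians, each of which is a translated Gaussian of parameter \<open>card S\<close> with a factor in
  the unit interval. Its norm in the native space of \<open>\<Phi>\<close> is therefore bounded independently of \<open>z\<close>.\<close>
lemma sum_squared_le_quadratic_form:
  fixes \<Phi> :: "'a::euclidean_space \<Rightarrow> real"
  assumes I: "finite (I :: 'i set)"
    and dom: "\<And>s. s > 0 \<Longrightarrow>
      \<exists>M>0. \<forall>(I::'i set) z a. quadratic_form (\<lambda>x. exp (- (s * (norm x)\<^sup>2))) I z a \<le> M * quadratic_form \<Phi> I z a"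
  shows "\<exists>B. \<forall>z a. (\<Sum>i\<in>I. a i)\<^sup>2 \<le> B * quadratic_form \<Phi> I z a"
proof -
  obtain M where M: "\<And>s (I::'i set) z a. s > 0 \<Longrightarrow>
      quadratic_form (\<lambda>x. exp (- (s * (norm x)\<^sup>2))) I z a \<le> M s * quadratic_form \<Phi> I z a"
    using dom by metis
  let ?P = "Pow I - {{}}"
  have "(\<Sum>i\<in>I. a i)\<^sup>2 \<le> (real (card ?P) * (\<Sum>S\<in>?P. M (card S))) * quadratic_form \<Phi> I z a" for z a
  proof -
    define g where "g i j = exp (- (norm (z i - z j))\<^sup>2)" for i j
    define q where "q S = (\<Sum>i\<in>I. a i * (\<Prod>j\<in>S. g i j))" for S
    \<comment> \<open>The factor with index \<open>j = i\<close> of the product is zero.\<close>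
    have vanish: "(\<Sum>S\<in>Pow I. (- 1) ^ card S * (\<Prod>j\<in>S. g i j)) = 0" if "i \<in> I" for i
    proof -
      have "(\<Prod>j\<in>I. - g i j + 1) = 0"
        using that I by (intro prod_zero) (auto simp: g_def)
      then have "(\<Sum>S\<in>Pow I. (\<Prod>j\<in>S. - g i j)) = 0"
        using prod_add[OF I, of "\<lambda>j. - g i j" "\<lambda>_. 1"] by simp
      moreover have "(\<Prod>j\<in>S. - g i j) = (- 1) ^ card S * (\<Prod>j\<in>S. g i j)" for S
        using prod.distrib[of "\<lambda>_. - 1" "g i" S] by simp
      ultimately show ?thesis by simp
    qed
    have "(\<Sum>S\<in>Pow I. (- 1) ^ card S * q S) = (\<Sum>i\<in>I. a i * (\<Sum>S\<in>Pow I. (- 1) ^ card S * (\<Prod>j\<in>S. g i j)))"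
      unfolding q_def sum_distrib_left by (subst sum.swap) (simp add: mult_ac)
    also have "\<dots> = 0" by (simp add: vanish)
    finally have "(\<Sum>S\<in>Pow I. (- 1) ^ card S * q S) = 0" .
    moreover have "(\<Sum>S\<in>Pow I. (- 1) ^ card S * q S) = q {} + (\<Sum>S\<in>?P. (- 1) ^ card S * q S)"
      using I by (subst sum.remove[of _ "{}"]) auto
    moreover have "q {} = (\<Sum>i\<in>I. a i)" by (simp add: q_def)
    ultimately have "(\<Sum>i\<in>I. a i)\<^sup>2 = (\<Sum>S\<in>?P. (- 1) ^ card S * q S)\<^sup>2"
      by (simp add: eq_neg_iff_add_eq_0[symmetric])
    also have "\<dots> \<le> (\<Sum>S\<in>?P. ((- 1) ^ card S * q S)\<^sup>2) * real (card ?P)"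
      by (rule sum_squared_le_sum_of_squares)
    also have "\<dots> = (\<Sum>S\<in>?P. (q S)\<^sup>2) * real (card ?P)"
      by (simp add: power_mult_distrib flip: power_mult)
    also have "\<dots> \<le> (\<Sum>S\<in>?P. M (card S) * quadratic_form \<Phi> I z a) * real (card ?P)"
    proof (intro mult_right_mono sum_mono)
      fix S assume "S \<in> ?P"
      then have S: "finite S" "S \<noteq> {}" using I finite_subset by auto
      then have card: "real (card S) > 0" by (simp add: card_gt_0_iff)
      obtain p C where C: "0 \<le> C" "C \<le> 1"
        "\<And>w. (\<Prod>j\<in>S. exp (- (norm (w - z j))\<^sup>2)) = C * exp (- (real (card S) * (norm (w - p))\<^sup>2))"
        by (rule gaussian_product[OF S, of z]) (rule that)
      let ?b = "\<Sum>i\<in>I. a i * exp (- (real (card S) * (norm (z i - p))\<^sup>2))"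
      have "(q S)\<^sup>2 = C\<^sup>2 * ?b\<^sup>2"
        unfolding q_def g_def C(3) by (simp add: sum_distrib_left mult_ac flip: power_mult_distrib)
      also have "\<dots> \<le> 1 * ?b\<^sup>2"
        using C by (intro mult_right_mono) (simp_all add: power_le_one)
      also have "\<dots> \<le> quadratic_form (\<lambda>x. exp (- (real (card S) * (norm x)\<^sup>2))) I z a"
        using gaussian_sum_squared_le[OF card I] by simp
      also have "\<dots> \<le> M (card S) * quadratic_form \<Phi> I z a"
        by (rule M[OF card])
      finally show "(q S)\<^sup>2 \<le> M (card S) * quadratic_form \<Phi> I z a" .
    qed simp
    finally show ?thesis by (simp only: sum_distrib_right[symmetric] mult_ac)
  qed
  then show ?thesis by blast
qed

section \<open>Positive-definite kernels\<close>

text \<open>Transfers strict positivity from points indexed by an initial segment of the naturals to any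
  finite index set.\<close>
lemma quadratic_form_pos:
  assumes pd: "positive_definite_kernel (\<lambda>x y. \<Phi> (x - y))"
    and I: "finite I" and inj: "inj_on z I" and a: "\<exists>i\<in>I. a i \<noteq> 0"
  shows "quadratic_form \<Phi> I z a > 0"
proof -
  obtain h where h: "bij_betw h {..<card I} I"
    using ex_bij_betw_nat_finite[OF I] by (auto simp: lessThan_atLeast0)
  have "0 < (\<Sum>i<card I. \<Sum>j<card I. (a \<circ> h) i * (a \<circ> h) j * \<Phi> ((z \<circ> h) i - (z \<circ> h) j))"
  proof -
    have "inj_on (z \<circ> h) {..<card I}"
      using h inj by (auto simp: bij_betw_def intro: comp_inj_on)
    moreover have "\<exists>i<card I. (a \<circ> h) i \<noteq> 0"
      using a h by (force simp: bij_betw_def)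
    ultimately show ?thesis
      using pd unfolding positive_definite_kernel_def by blast
  qed
  also have "\<dots> = quadratic_form \<Phi> I z a"
    using sum.reindex_bij_betw[OF h, of "\<lambda>i. \<Sum>j\<in>I. a i * a j * \<Phi> (z i - z j)"]
      sum.reindex_bij_betw[OF h, of "\<lambda>j. a i * a j * \<Phi> (z i - z j)" for i]
    by (simp add: quadratic_form_def)
  finally show ?thesis .
qed

text \<open>Positivity of the forms on the points \<open>0\<close> and \<open>x\<close> with coefficients \<open>1\<close> and \<open>\<plusminus>1\<close>. These points
  must be distinct, so \<open>x = 0\<close> is treated by a form on a single point.\<close>
lemma positive_definite_bounded:
  assumes pd: "positive_definite_kernel (\<lambda>x y. \<Phi> (x - y))"
  shows "\<bar>\<Phi> x\<bar> \<le> \<Phi> (0 :: 'a::ab_group_add)"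
proof (cases "x = 0")
  case True
  have "quadratic_form \<Phi> {()} (\<lambda>_. 0) (\<lambda>_. 1) > 0"
    by (rule quadratic_form_pos[OF pd]) auto
  then show ?thesis using True by (simp add: quadratic_form_def)
next
  case False
  have sym: "\<Phi> (- x) = \<Phi> x"
    using pd unfolding positive_definite_kernel_def by (metis diff_0 diff_zero)
  have "0 < quadratic_form \<Phi> {False, True} (\<lambda>b. if b then x else 0) (\<lambda>b. if b then e else 1)" if "e = 1 \<or> e = -1" for e
    using False by (intro quadratic_form_pos[OF pd]) (auto simp: inj_on_def)
  from this[of 1] this[of "-1"] show ?thesis
    by (simp add: quadratic_form_def sym)
qed

lemma sum_option: "(\<Sum>i\<in>UNIV. f i) = f None + (\<Sum>i\<in>UNIV. f (Some i))" for f :: "'n::finite option \<Rightarrow> real"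
  by (simp add: UNIV_option_conv sum.reindex)

section \<open>Conditional mean and covariance through prediction weights\<close>

text \<open>The coefficients of the best linear predictor of the value at \<open>x\<close> from the values on \<open>X\<close>.\<close>
definition kriging_weights :: "('a \<Rightarrow> 'a \<Rightarrow> real) \<Rightarrow> ('n::finite \<Rightarrow> 'a) \<Rightarrow> 'a \<Rightarrow> real^'n" where
  "kriging_weights K X x = matrix_inv (kernel_matrix K X) *v kernel_col K X x"

lemma matrix_inv_right:
  assumes "invertible A" shows "A ** matrix_inv A = mat 1"
  using assms unfolding invertible_def matrix_inv_def by (rule someI2_ex) blast

context
  fixes K :: "'a \<Rightarrow> 'a \<Rightarrow> real" and X :: "'n::finite \<Rightarrow> 'a"
  assumes sym: "\<And>x y. K x y = K y x" and inv: "invertible (kernel_matrix K X)"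
begin

lemma kernel_matrix_mult_weights:
  "kernel_matrix K X *v kriging_weights K X x = kernel_col K X x"
  by (simp add: kriging_weights_def matrix_vector_mul_assoc matrix_inv_right[OF inv])

lemma kernel_matrix_inner:
  "(kernel_matrix K X *v v) \<bullet> w = v \<bullet> (kernel_matrix K X *v w)"
proof -
  have "transpose (kernel_matrix K X) = kernel_matrix K X"
    by (simp add: transpose_def kernel_matrix_def sym vec_eq_iff)
  then show ?thesis
    by (metis dot_lmul_matrix vector_transpose_matrix)
qed

lemma kernel_row_inner_inv:
  "kernel_row K x X \<bullet> (matrix_inv (kernel_matrix K X) *v w) = kriging_weights K X x \<bullet> w"
proof -
  have "kernel_row K x X = kernel_col K X x"
    by (simp add: kernel_row_def kernel_col_def sym)
  then have "kernel_row K x X \<bullet> (matrix_inv (kernel_matrix K X) *v w)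
      = (kernel_matrix K X *v kriging_weights K X x) \<bullet> (matrix_inv (kernel_matrix K X) *v w)"
    by (simp add: kernel_matrix_mult_weights)
  also have "\<dots> = kriging_weights K X x \<bullet> w"
    by (simp add: kernel_matrix_inner matrix_vector_mul_assoc matrix_inv_right[OF inv])
  finally show ?thesis .
qed

lemma conditional_cov_weights:
  "conditional_cov K X x y = K x y - (\<Sum>i\<in>UNIV. kriging_weights K X x $ i * K (X i) y)"
  unfolding conditional_cov_def kernel_row_inner_inv by (simp add: inner_vec_def kernel_col_def)

lemma conditional_cov_sym: "conditional_cov K X x y = conditional_cov K X y x"
proof -
  have "kriging_weights K X x \<bullet> kernel_col K X y = kriging_weights K X y \<bullet> kernel_col K X x"
    by (metis kernel_matrix_mult_weights kernel_matrix_inner inner_commute)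
  then show ?thesis
    by (simp add: conditional_cov_def kernel_row_inner_inv sym)
qed

lemma conditional_mean_const:
  assumes "residual m X Y = (\<chi> i. c)"
  shows "conditional_mean K m X Y x = m x + c * (\<Sum>i\<in>UNIV. kriging_weights K X x $ i)"
  unfolding conditional_mean_def kernel_row_inner_inv assms
  by (simp add: inner_vec_def sum_distrib_left mult.commute)

text \<open>The conditional covariance is the covariance of prediction errors: the left-hand side is the
  variance of \<open>\<alpha>\<close> times the error at \<open>x\<close> plus \<open>\<beta>\<close> times the error at \<open>y\<close>. The nested option type
  indexes the points \<open>x\<close>, \<open>y\<close> and \<open>X i\<close>.\<close>
lemma conditional_cov_quadratic:
  fixes \<alpha> \<beta> :: real and x y :: 'a
  defines "w \<equiv> \<alpha> *\<^sub>R kriging_weights K X x + \<beta> *\<^sub>R kriging_weights K X y"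
  defines "z \<equiv> case_option x (case_option y X)"
    and "b \<equiv> case_option \<alpha> (case_option \<beta> (\<lambda>i. - w $ i))"
  shows "\<alpha>\<^sup>2 * conditional_cov K X x x + 2 * \<alpha> * \<beta> * conditional_cov K X x y + \<beta>\<^sup>2 * conditional_cov K X y y
       = (\<Sum>i\<in>UNIV. \<Sum>j\<in>UNIV. b i * b j * K (z i) (z j))"
proof -
  let ?u = "kriging_weights K X x" and ?v = "kriging_weights K X y"
  \<comment> \<open>Prediction errors are uncorrelated with the data, so the rows of the double sum that belong to
    data points vanish.\<close>
  have orth: "\<alpha> * K (X i) x + \<beta> * K (X i) y - (\<Sum>j\<in>UNIV. w $ j * K (X i) (X j)) = 0" for i
  proof -
    have "kernel_matrix K X *v w = \<alpha> *\<^sub>R kernel_col K X x + \<beta> *\<^sub>R kernel_col K X y"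
      by (simp add: w_def matrix_vector_right_distrib matrix_vector_mult_scaleR kernel_matrix_mult_weights)
    then have "(kernel_matrix K X *v w) $ i = (\<alpha> *\<^sub>R kernel_col K X x + \<beta> *\<^sub>R kernel_col K X y) $ i"
      by simp
    then show ?thesis
      by (simp add: matrix_vector_mult_def kernel_matrix_def kernel_col_def mult.commute)
  qed
  have row: "(\<Sum>j\<in>UNIV. b i * b j * K (z i) (z j))
      = b i * (\<alpha> * K (z i) x + \<beta> * K (z i) y - (\<Sum>j\<in>UNIV. w $ j * K (z i) (X j)))" for i
    by (simp add: sum_option b_def z_def sum_distrib_left sum_negf algebra_simps)
  have w: "(\<Sum>j\<in>UNIV. w $ j * K t (X j)) = \<alpha> * (\<Sum>j\<in>UNIV. ?u $ j * K (X j) t) + \<beta> * (\<Sum>j\<in>UNIV. ?v $ j * K (X j) t)" for t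
    by (simp add: w_def sum.distrib sum_distrib_left algebra_simps sym[of t])
  have "(\<Sum>i\<in>UNIV. \<Sum>j\<in>UNIV. b i * b j * K (z i) (z j))
      = \<alpha> * (\<alpha> * K x x + \<beta> * K x y - (\<Sum>j\<in>UNIV. w $ j * K x (X j)))
      + \<beta> * (\<alpha> * K y x + \<beta> * K y y - (\<Sum>j\<in>UNIV. w $ j * K y (X j)))"
    unfolding row by (simp add: sum_option z_def orth) (simp add: b_def)
  also have "\<dots> = \<alpha> * (\<alpha> * conditional_cov K X x x + \<beta> * conditional_cov K X y x)
      + \<beta> * (\<alpha> * conditional_cov K X x y + \<beta> * conditional_cov K X y y)"
    unfolding w conditional_cov_weights by (simp add: algebra_simps sym[of x y])
  finally show ?thesis
    by (simp add: conditional_cov_sym[of y x] algebra_simps power2_eq_square)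
qed

text \<open>Best linear prediction from all of \<open>X\<close> is at least as good as prediction by the single value
  at \<open>X i\<close>. The gap is the form of the difference of the two weight vectors.\<close>
lemma conditional_var_le:
  assumes nonneg: "\<And>v. v \<bullet> (kernel_matrix K X *v v) \<ge> 0"
  shows "conditional_cov K X x x \<le> K x x - 2 * K (X i) x + K (X i) (X i)"
proof -
  let ?A = "kernel_matrix K X" and ?u = "kriging_weights K X x" and ?e = "axis i 1 :: real^'n"
  have "0 \<le> (?e - ?u) \<bullet> (?A *v (?e - ?u))" by (rule nonneg)
  also have "\<dots> = ?e \<bullet> (?A *v ?e) - 2 * (?e \<bullet> (?A *v ?u)) + ?u \<bullet> (?A *v ?u)"
    using kernel_matrix_inner[of ?e ?u] inner_commute[of ?u "?A *v ?e"]
    by (simp add: matrix_vector_mult_diff_distrib inner_diff_left inner_diff_right)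
  also have "?e \<bullet> (?A *v ?e) = K (X i) (X i)"
    by (simp add: inner_axis' kernel_matrix_def matrix_vector_mult_basis column_def)
  also have "?e \<bullet> (?A *v ?u) = K (X i) x"
    by (simp only: kernel_matrix_mult_weights) (simp add: inner_axis' kernel_col_def)
  also have "?u \<bullet> (?A *v ?u) = ?u \<bullet> kernel_col K X x"
    by (simp only: kernel_matrix_mult_weights)
  finally show ?thesis
    by (simp add: conditional_cov_def kernel_row_inner_inv)
qed

end

section \<open>The flat limit\<close>

lemma quadratic_form_scaled:
  "(\<Sum>i\<in>I. \<Sum>j\<in>I. a i * a j * scaled_kernel \<Phi> l (z i) (z j)) = quadratic_form \<Phi> I (\<lambda>i. z i /\<^sub>R l) a"
  by (simp add: quadratic_form_def scaled_kernel_def scaleR_diff_right)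

lemma kernel_matrix_form_scaled:
  "v \<bullet> (kernel_matrix (scaled_kernel \<Phi> l) X *v v) = quadratic_form \<Phi> UNIV (\<lambda>i. X i /\<^sub>R l) (\<lambda>i. v $ i)"
  unfolding quadratic_form_scaled[symmetric]
  by (simp add: inner_vec_def matrix_vector_mult_def kernel_matrix_def sum_distrib_left mult_ac)

text \<open>A vector in the kernel of the matrix makes its quadratic form vanish, which strict positivity
  excludes for a nonzero vector because the rescaled points remain distinct.\<close>
lemma invertible_kernel_matrix_scaled:
  fixes X :: "'n::finite \<Rightarrow> 'a::real_vector"
  assumes pd: "positive_definite_kernel (\<lambda>x y. \<Phi> (x - y))" and X: "inj X" and l: "l > 0"
  shows "invertible (kernel_matrix (scaled_kernel \<Phi> l) X)"
proof -
  let ?A = "kernel_matrix (scaled_kernel \<Phi> l) X"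
  have "v = 0" if "?A *v v = 0" for v
  proof (rule ccontr)
    assume "v \<noteq> 0"
    then have "quadratic_form \<Phi> UNIV (\<lambda>i. X i /\<^sub>R l) (\<lambda>i. v $ i) > 0"
      using X l by (intro quadratic_form_pos[OF pd]) (auto simp: inj_on_def vec_eq_iff)
    then show False
      using that by (simp flip: kernel_matrix_form_scaled)
  qed
  then show ?thesis
    by (simp add: invertible_left_inverse matrix_left_invertible_ker)
qed

theorem theorem2p6:
  fixes \<Phi> :: "real^'d \<Rightarrow> real"
    and X :: "'n::finite \<Rightarrow> real^'d"
    and m :: "real^'d \<Rightarrow> real"
    and Y :: "real^'n"
    and C1 C2 \<alpha> c :: real
    and x y :: "real^'d"
  assumes "inj X"
    and "positive_definite_kernel (\<lambda>x y. \<Phi> (x - y))"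
    and "continuous_on UNIV \<Phi>"
    and "integrable lborel \<Phi>"
    and "C1 > 0" and "C2 > 0" and "\<alpha> > real CARD('d) / 2"
    and "\<And>\<xi>. C1 * (1 + (norm \<xi>)\<^sup>2) powr (- \<alpha>) \<le> Re (fourier_transform \<Phi> \<xi>)"
    and "\<And>\<xi>. Re (fourier_transform \<Phi> \<xi>) \<le> C2 * (1 + (norm \<xi>)\<^sup>2) powr (- \<alpha>)"
    and "residual m X Y = (\<chi> i. c)"
  shows "((\<lambda>l. conditional_mean (scaled_kernel \<Phi> l) m X Y x) \<longlongrightarrow> m x + c) at_top \<and>
         ((\<lambda>l. abs_P (scaled_kernel \<Phi> l) X x y) \<longlongrightarrow> 0) at_top"
proof -
  note pd = assms(2)
  let ?K = "scaled_kernel \<Phi>"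
  let ?V = "\<lambda>l. conditional_cov (?K l) X"
  let ?s = "\<lambda>l. \<Sum>i\<in>UNIV. kriging_weights (?K l) X x $ i"
  obtain i0 :: 'n where True by simp
  have \<alpha>: "\<alpha> > 0"
    using assms(7) by (rule order.strict_trans1[rotated]) simp
  have bdd: "\<bar>\<Phi> x\<bar> \<le> \<Phi> 0" for x
    by (rule positive_definite_bounded[OF pd])
  have sym: "?K l t t' = ?K l t' t" for l t t'
  proof -
    have "\<Phi> (a - b) = \<Phi> (b - a)" for a b
      using pd unfolding positive_definite_kernel_def by blast
    from this[of "t /\<^sub>R l" "t' /\<^sub>R l"] show ?thesis
      by (simp add: scaled_kernel_def scaleR_diff_right)
  qed
  have inv: "invertible (kernel_matrix (?K l) X)" if "l > 0" for l
    by (rule invertible_kernel_matrix_scaled[OF pd assms(1) that])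
  have nonneg: "quadratic_form \<Phi> I z a \<ge> 0" for I z a
  proof (rule quadratic_form_nonneg_of_fourier[OF assms(4,3) bdd])
    show "0 \<le> Re (fourier_transform \<Phi> \<xi>)" for \<xi>
      using assms(5) by (intro order.trans[OF _ assms(8)]) simp
  qed
  have cov: "(e::real)\<^sup>2 * ?V l t t + 2 * e * f * ?V l t t' + f\<^sup>2 * ?V l t' t' =
      quadratic_form \<Phi> UNIV (\<lambda>i. case_option t (case_option t' X) i /\<^sub>R l)
        (case_option e (case_option f (\<lambda>i. - (e *\<^sub>R kriging_weights (?K l) X t + f *\<^sub>R kriging_weights (?K l) X t') $ i)))"
    if "l > 0" for l t t' e f
    unfolding conditional_cov_quadratic[OF sym inv[OF that]] quadratic_form_scaled ..

  have var_nonneg: "?V l t t \<ge> 0" if "l > 0" for l t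
    using cov[OF that, of 1 t 0 t] nonneg by simp
  \<comment> \<open>The variances of the sum and of the difference of the errors at \<open>x\<close> and \<open>y\<close> are nonnegative.\<close>
  have cov_le: "\<bar>?V l x y\<bar> \<le> (?V l x x + ?V l y y) / 2" if "l > 0" for l
  proof -
    have "?V l x x + 2 * ?V l x y + ?V l y y \<ge> 0"
      using cov[OF that, of 1 x 1 y] nonneg by simp
    moreover have "?V l x x - 2 * ?V l x y + ?V l y y \<ge> 0"
      using cov[OF that, of 1 x "-1" y] nonneg by simp
    ultimately show ?thesis by (intro abs_leI) (simp_all add: field_simps)
  qed
  have var_le: "?V l t t \<le> 2 * \<Phi> 0 - 2 * \<Phi> ((X i0 - t) /\<^sub>R l)" if "l > 0" for l t
  proof -
    have "v \<bullet> (kernel_matrix (?K l) X *v v) \<ge> 0" for v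
      unfolding kernel_matrix_form_scaled by (rule nonneg)
    from conditional_var_le[OF sym inv[OF that] this, of t i0] show ?thesis
      by (simp add: scaled_kernel_def)
  qed
  have var_tendsto: "((\<lambda>l. ?V l t t) \<longlongrightarrow> 0) at_top" for t
  proof (rule tendsto_sandwich)
    show "\<forall>\<^sub>F l in at_top. 0 \<le> ?V l t t"
      using eventually_gt_at_top[of "0::real"] by eventually_elim (rule var_nonneg)
    show "\<forall>\<^sub>F l in at_top. ?V l t t \<le> 2 * \<Phi> 0 - 2 * \<Phi> ((X i0 - t) /\<^sub>R l)"
      using eventually_gt_at_top[of "0::real"] by eventually_elim (rule var_le)
    have "((\<lambda>l. inverse l *\<^sub>R (X i0 - t)) \<longlongrightarrow> 0 *\<^sub>R (X i0 - t)) at_top"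
      by (intro tendsto_intros tendsto_inverse_0_at_top filterlim_ident)
    then have "((\<lambda>l. \<Phi> ((X i0 - t) /\<^sub>R l)) \<longlongrightarrow> \<Phi> 0) at_top"
      using assms(3) by (intro continuous_on_tendsto_compose[of UNIV \<Phi>]) auto
    from tendsto_diff[OF tendsto_const tendsto_mult[OF tendsto_const this], of "2 * \<Phi> 0" 2]
    show "((\<lambda>l. 2 * \<Phi> 0 - 2 * \<Phi> ((X i0 - t) /\<^sub>R l)) \<longlongrightarrow> 0) at_top"
      by simp
  qed simp

  have "((\<lambda>l. ?V l x y) \<longlongrightarrow> 0) at_top"
  proof (rule Lim_null_comparison)
    show "\<forall>\<^sub>F l in at_top. norm (?V l x y) \<le> (?V l x x + ?V l y y) / 2"
      using eventually_gt_at_top[of "0::real"] by eventually_elim (simp add: cov_le del: le_divide_eq_numeral1)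
    show "((\<lambda>l. (?V l x x + ?V l y y) / 2) \<longlongrightarrow> 0) at_top"
      using tendsto_divide[OF tendsto_add[OF var_tendsto var_tendsto] tendsto_const, of 2 x y] by simp
  qed
  then have P: "((\<lambda>l. abs_P (?K l) X x y) \<longlongrightarrow> 0) at_top"
    unfolding abs_P_def using tendsto_real_sqrt[OF tendsto_rabs] by force

  obtain B where B: "\<And>z a. (\<Sum>i\<in>(UNIV::'n option option set). a i)\<^sup>2 \<le> B * quadratic_form \<Phi> UNIV z a"
    using sum_squared_le_quadratic_form[OF finite
        gaussian_form_dominated[OF assms(4,3) bdd assms(5) \<alpha> assms(8)]] by blast
  have "((\<lambda>l. 1 - ?s l) \<longlongrightarrow> 0) at_top"
  proof -
    \<comment> \<open>The error at \<open>x\<close> has coefficient \<open>1\<close> at \<open>x\<close> and minus the weights on \<open>X\<close>; the sum of these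
    coefficients is the defect in reproducing constants. The coefficient at the second point is
    taken to be zero.\<close>
    have sq: "norm ((1 - ?s l)\<^sup>2) \<le> B * ?V l x x" if "l > 0" for l
      using cov[OF that, of 1 x 0 x]
        B[of "case_option 1 (case_option 0 (\<lambda>i. - kriging_weights (?K l) X x $ i))"
          "\<lambda>i. case_option x (case_option x X) i /\<^sub>R l"]
      by (simp add: sum_option sum_negf)
    have "\<forall>\<^sub>F l in at_top. norm ((1 - ?s l)\<^sup>2) \<le> B * ?V l x x"
      using eventually_gt_at_top[of "0::real"] by eventually_elim (rule sq)
    moreover have "((\<lambda>l. B * ?V l x x) \<longlongrightarrow> 0) at_top"
      using tendsto_mult[OF tendsto_const var_tendsto] by force
    ultimately have "((\<lambda>l. (1 - ?s l)\<^sup>2) \<longlongrightarrow> 0) at_top"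
      by (rule Lim_null_comparison)
    from tendsto_real_sqrt[OF this] show ?thesis
      by (simp add: tendsto_rabs_zero_iff)
  qed
  from tendsto_diff[OF tendsto_const tendsto_mult[OF tendsto_const this], of "m x + c" c]
  have "((\<lambda>l. m x + c * ?s l) \<longlongrightarrow> m x + c) at_top"
    by (simp add: algebra_simps)
  then have "((\<lambda>l. conditional_mean (?K l) m X Y x) \<longlongrightarrow> m x + c) at_top"
  proof (rule Lim_transform_eventually)
    show "\<forall>\<^sub>F l in at_top. m x + c * ?s l = conditional_mean (?K l) m X Y x"
      using eventually_gt_at_top[of "0::real"]
      by eventually_elim (simp add: conditional_mean_const[OF sym inv assms(10)])
  qed
  with P show ?thesis by blast
qed

end
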